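(* Let $E\neq\{0\}$ be a regular indecomposable self-adjoint $(a,b)$-module. Then $E$ admits a nondegenerate $(a,b)$-hermitian form or a nondegenerate anti-$(a,b)$-hermitian form. Equivalently, there is an isomorphism of $(a,b)$-modules $\Phi:E\to\breve{E}^*$ with $\breve{\Phi}^*=\Phi$, or there is an isomorphism of $(a,b)$-modules $\Phi:E\to\breve{E}^*$ with $\breve{\Phi}^*=-\Phi$.
   Context: An $(a,b)$-module is a free $\mathbb{C}[[b]]$-module $E$ of finite rank with a $\mathbb{C}$-linear map $a:E\to E$ such that $ab-ba=b^2$, where $b$ also denotes multiplication by $b$. A morphism of $(a,b)$-modules is a $\mathbb{C}[[b]]$-linear map commuting with $a$; an isomorphism is a bijective morphism. A sub-$(a,b)$-module is a $\mathbb{C}[[b]]$-submodule stable under $a$. $E$ is a simple-pole $(a,b)$-module if $aE\subset bE$, and $E$ is regular if it is (isomorphic to) a sub-$(a,b)$-module of a simple-pole $(a,b)$-module. $E$ is indecomposable if it cannot be written as a direct sum $F\oplus G$ of nonzero $(a,b)$-modules. $E_0=\mathbb{C}[[b]]e_0$ is the rank one $(a,b)$-module with $ae_0=0$. For $S\in\mathbb{C}[[b]]$ put $\breve{S}(b)=S(-b)$, and for $u=S(b)e_0\in E_0$ put $\breve u=S(-b)e_0$. The adjoint $\breve{E}^*$ of $E$ is the set $\mathrm{Hom}_{\mathbb{C}[[b]]}(E,E_0)$ with the $(a,b)$-structure $(b\cdot\phi)(x)=-b\,\phi(x)$ and $(a\cdot\phi)(x)=\phi(ax)-a\,\phi(x)$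 (that is, the dual $(a,b)$-module $E^*$ with the signs of both $a$ and $b$ changed). $E$ is self-adjoint if $E\simeq\breve{E}^*$ as $(a,b)$-modules. A nondegenerate $(a,b)$-sesquilinear form on $E$ amounts to an isomorphism of $(a,b)$-modules $\Phi:E\to\breve{E}^*$. The adjoint of a morphism $\Phi:E\to\breve{E}^*$ is the morphism $\breve{\Phi}^*:E\to\breve{E}^*$ given by $\breve{\Phi}^*(v)(w)=\big(\Phi(w)(v)\big)\breve{}$ for $v,w\in E$. The form is $(a,b)$-hermitian if $\breve\Phi^*=\Phi$ and anti-$(a,b)$-hermitian if $\breve\Phi^*=-\Phi$. *)

theory Defs
  imports Complex_Main
    "HOL-Computational_Algebra.Formal_Power_Series"
    "HOL-Library.Function_Algebras"
begin

text \<open>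
  A structure consists of a carrier inside an additive group, a scalar multiplication by
  \<open>\<complex>[[b]] = complex fps\<close> (so that \<open>b\<close> acts as the scalar \<open>fps_X\<close>) and the map \<open>a\<close>.
  Scalar multiplication is required to be a module structure on the whole ambient group;
  the (a,b)-module itself is a submodule of it, possibly everything.
\<close>

record 'v ab_struct =
  pts :: "'v set"
  smult :: "complex fps \<Rightarrow> 'v \<Rightarrow> 'v"
  aop :: "'v \<Rightarrow> 'v"

abbreviation bop :: "('v, 'm) ab_struct_scheme \<Rightarrow> 'v \<Rightarrow> 'v"
  where "bop E \<equiv> smult E fps_X"

definition ab_module :: "'v::ab_group_add ab_struct \<Rightarrow> bool" where
  "ab_module E \<longleftrightarrow>
     module (smult E) \<and>
     module.subspace (smult E) (pts E) \<and>
     (\<exists>B. finite B \<and> \<not> module.dependent (smult E) B \<and> module.span (smult E) B = pts E) \<and>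
     (\<forall>x\<in>pts E. aop E x \<in> pts E) \<and>
     (\<forall>x\<in>pts E. \<forall>y\<in>pts E. aop E (x + y) = aop E x + aop E y) \<and>
     (\<forall>c. \<forall>x\<in>pts E. aop E (smult E (fps_const c) x) = smult E (fps_const c) (aop E x)) \<and>
     (\<forall>x\<in>pts E. aop E (bop E x) - bop E (aop E x) = bop E (bop E x))"

definition fps_linear ::
    "'v::ab_group_add ab_struct \<Rightarrow> 'w::ab_group_add ab_struct \<Rightarrow> ('v \<Rightarrow> 'w) \<Rightarrow> bool" where
  "fps_linear E F f \<longleftrightarrow>
     (\<forall>x\<in>pts E. f x \<in> pts F) \<and>
     (\<forall>x\<in>pts E. \<forall>y\<in>pts E. f (x + y) = f x + f y) \<and>
     (\<forall>s. \<forall>x\<in>pts E. f (smult E s x) = smult F s (f x))"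

definition ab_hom ::
    "'v::ab_group_add ab_struct \<Rightarrow> 'w::ab_group_add ab_struct \<Rightarrow> ('v \<Rightarrow> 'w) \<Rightarrow> bool" where
  "ab_hom E F f \<longleftrightarrow> fps_linear E F f \<and> (\<forall>x\<in>pts E. f (aop E x) = aop F (f x))"

definition ab_iso ::
    "'v::ab_group_add ab_struct \<Rightarrow> 'w::ab_group_add ab_struct \<Rightarrow> ('v \<Rightarrow> 'w) \<Rightarrow> bool" where
  "ab_iso E F f \<longleftrightarrow> ab_hom E F f \<and> bij_betw f (pts E) (pts F)"

definition sub_ab_module :: "'v::ab_group_add ab_struct \<Rightarrow> 'v set \<Rightarrow> bool" where
  "sub_ab_module E W \<longleftrightarrow>
     W \<subseteq> pts E \<and> module.subspace (smult E) W \<and> (\<forall>x\<in>W. aop E x \<in> W)"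

definition simple_pole :: "'v::ab_group_add ab_struct \<Rightarrow> bool" where
  "simple_pole E \<longleftrightarrow> ab_module E \<and> aop E ` pts E \<subseteq> bop E ` pts E"

text \<open>
  HOL cannot quantify over the type of the ambient simple-pole module. Nothing is lost by taking
  \<open>nat \<Rightarrow> complex fps\<close>, which contains a free module of every finite rank:
  see \<open>regularI\<close> below.
\<close>

definition regular :: "'v::ab_group_add ab_struct \<Rightarrow> bool" where
  "regular E \<longleftrightarrow>
     (\<exists>(P :: (nat \<Rightarrow> complex fps) ab_struct) W f.
        simple_pole P \<and> sub_ab_module P W \<and> ab_iso E (P\<lparr>pts := W\<rparr>) f)"

definition indecomposable :: "'v::ab_group_add ab_struct \<Rightarrow> bool" where
  "indecomposable E \<longleftrightarrow>
     \<not> (\<exists>F G. F \<subseteq> pts E \<and> G \<subseteq> pts E \<and>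
          ab_module (E\<lparr>pts := F\<rparr>) \<and> ab_module (E\<lparr>pts := G\<rparr>) \<and>
          F \<noteq> {0} \<and> G \<noteq> {0} \<and>
          F \<inter> G = {0} \<and> pts E = {x + y | x y. x \<in> F \<and> y \<in> G})"

text \<open>
  \<open>E\<^sub>0\<close> with \<open>e\<^sub>0 = 1\<close>: the relation \<open>ab - ba = b\<^sup>2\<close> and \<open>a e\<^sub>0 = 0\<close> force
  \<open>a (S e\<^sub>0) = b\<^sup>2 S' e\<^sub>0\<close>; see \<open>rank_one_aop\<close>.
\<close>

definition E0 :: "complex fps ab_struct" where
  "E0 = \<lparr>pts = UNIV, smult = (*), aop = (\<lambda>S. fps_X\<^sup>2 * fps_deriv S)\<rparr>"

definition breve :: "complex fps \<Rightarrow> complex fps" where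
  "breve S = S oo (- fps_X)"

text \<open>
  Homomorphisms are represented by functions vanishing outside the carrier. The scalar
  \<open>S(b)\<close> acts through \<open>S(-b)\<close>, as \<open>b\<close> acts through \<open>-b\<close>.
\<close>

definition adjoint :: "'v::ab_group_add ab_struct \<Rightarrow> ('v \<Rightarrow> complex fps) ab_struct" where
  "adjoint E =
     \<lparr>pts = {\<phi>. fps_linear E E0 \<phi> \<and> (\<forall>x. x \<notin> pts E \<longrightarrow> \<phi> x = 0)},
      smult = (\<lambda>S \<phi> x. breve S * \<phi> x),
      aop = (\<lambda>\<phi> x. if x \<in> pts E then \<phi> (aop E x) - aop E0 (\<phi> x) else 0)\<rparr>"

definition self_adjoint :: "'v::ab_group_add ab_struct \<Rightarrow> bool" where
  "self_adjoint E \<longleftrightarrow> (\<exists>f. ab_iso E (adjoint E) f)"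

definition adjoint_map ::
    "'v::ab_group_add ab_struct \<Rightarrow> ('v \<Rightarrow> 'v \<Rightarrow> complex fps) \<Rightarrow> 'v \<Rightarrow> 'v \<Rightarrow> complex fps" where
  "adjoint_map E \<Phi> v w = (if w \<in> pts E then breve (\<Phi> w v) else 0)"

definition nondegenerate_form ::
    "'v::ab_group_add ab_struct \<Rightarrow> ('v \<Rightarrow> 'v \<Rightarrow> complex fps) \<Rightarrow> bool" where
  "nondegenerate_form E \<Phi> \<longleftrightarrow> ab_iso E (adjoint E) \<Phi>"

definition ab_hermitian ::
    "'v::ab_group_add ab_struct \<Rightarrow> ('v \<Rightarrow> 'v \<Rightarrow> complex fps) \<Rightarrow> bool" where
  "ab_hermitian E \<Phi> \<longleftrightarrow> (\<forall>v\<in>pts E. adjoint_map E \<Phi> v = \<Phi> v)"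

definition anti_ab_hermitian ::
    "'v::ab_group_add ab_struct \<Rightarrow> ('v \<Rightarrow> 'v \<Rightarrow> complex fps) \<Rightarrow> bool" where
  "anti_ab_hermitian E \<Phi> \<longleftrightarrow> (\<forall>v\<in>pts E. adjoint_map E \<Phi> v = - \<Phi> v)"


lemma breve_nth: "fps_nth (breve S) n = (-1) ^ n * fps_nth S n"
  by (simp add: breve_def fps_compose_uminus')

lemma breve_simps [simp]:
  "breve 0 = 0" "breve 1 = 1" "breve (S + T) = breve S + breve T" "breve (- S) = - breve S"
  "breve (S * T) = breve S * breve T" "breve (S - T) = breve S - breve T"
  "breve fps_X = - fps_X" "breve (fps_const c) = fps_const c" "breve (breve S) = S"
proof -
  show "breve (breve S) = S"
    by (rule fps_ext) (simp add: breve_nth flip: mult.assoc power_add)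
qed (simp_all add: breve_def fps_compose_add_distrib fps_compose_uminus fps_compose_sub_distrib
       fps_compose_mult_distrib)

lemma breve_eq_0_iff [simp]: "breve S = 0 \<longleftrightarrow> S = 0"
  by (metis breve_simps(1,9))

lemma breve_fps_deriv: "breve (fps_deriv S) = - fps_deriv (breve S)"
  by (rule fps_ext) (simp add: breve_nth)

lemma breve_aop_E0: "breve (aop E0 S) = - aop E0 (breve S)"
  by (simp add: E0_def breve_fps_deriv power2_eq_square)

lemma module_fps_mult: "module ((*) :: complex fps \<Rightarrow> _)"
  by unfold_locales (simp_all add: algebra_simps)

lemma ab_module_E0: "ab_module E0"
proof -
  have comm: "fps_X\<^sup>2 * fps_deriv (fps_X * S) - fps_X * (fps_X\<^sup>2 * fps_deriv S) = fps_X * (fps_X * S)"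
    for S :: "complex fps"
    by (simp add: algebra_simps power2_eq_square)
  interpret module "(*) :: complex fps \<Rightarrow> _" by (rule module_fps_mult)
  have "x \<in> span {1}" for x
    by (metis mult.right_neutral span_base span_scale insertI1)
  moreover have "\<not> dependent {1 :: complex fps}"
    by (subst dependent_finite) auto
  ultimately have "\<exists>B. finite B \<and> \<not> dependent B \<and> span B = UNIV"
    by (intro exI[of _ "{1}"]) auto
  then show ?thesis
    using comm unfolding ab_module_def
    by (simp add: E0_def module_fps_mult distrib_left mult.left_commute)
qed

lemma aop_smult:
  assumes E: "ab_module E" and x: "x \<in> pts E"
  shows "aop E (smult E S x) = smult E S (aop E x) + smult E (fps_X\<^sup>2 * fps_deriv S) x"
proof -
  interpret module "smult E" using E by (simp add: ab_module_def)
  have add: "\<And>x y. x \<in> pts E \<Longrightarrow> y \<in> pts E \<Longrightarrow> x + y \<in> pts E"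
    and scale: "\<And>s x. x \<in> pts E \<Longrightarrow> smult E s x \<in> pts E"
    and aE: "\<And>x. x \<in> pts E \<Longrightarrow> aop E x \<in> pts E"
    using E by (auto simp: ab_module_def subspace_def)
  obtain B where B: "\<not> dependent B" "span B = pts E" "finite B"
    using E by (auto simp: ab_module_def)
  define R where "R S = smult E S (aop E x) + smult E (fps_X\<^sup>2 * fps_deriv S) x" for S
  have "\<exists>y\<in>pts E. aop E (smult E S x) = R S + smult E (fps_X ^ n) y" for n S
  proof (induction n arbitrary: S)
    case 0
    have "- smult E 1 (R S) \<in> pts E" "aop E (smult E S x) \<in> pts E"
      using x add scale aE scale_minus_left[of 1] by (auto simp: R_def simp flip: scale_minus_left)
    then show ?case by (intro bexI[of _ "aop E (smult E S x) - R S"]) (auto dest: add)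
  next
    case (Suc n)
    define c T where "c = fps_nth S 0" and "T = fps_shift 1 S"
    have S: "S = fps_const c + fps_X * T"
      by (rule fps_ext) (simp add: c_def T_def)
    obtain y where y: "y \<in> pts E" "aop E (smult E T x) = R T + smult E (fps_X ^ n) y"
      using Suc by blast
    have "aop E (smult E S x) = aop E (smult E (fps_const c) x) + aop E (bop E (smult E T x))"
      unfolding S using E x scale by (simp add: ab_module_def scale_left_distrib)
    also have "aop E (smult E (fps_const c) x) = smult E (fps_const c) (aop E x)"
      using E x by (simp add: ab_module_def)
    also have "aop E (bop E (smult E T x)) = bop E (aop E (smult E T x)) + bop E (bop E (smult E T x))"
    proof -
      have "aop E (bop E (smult E T x)) - bop E (aop E (smult E T x)) = bop E (bop E (smult E T x))"
        using E scale[OF x, of T] by (simp only: ab_module_def)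
      then show ?thesis by (simp only: diff_eq_eq add.commute)
    qed
    also have "smult E (fps_const c) (aop E x) + \<dots> = R S + smult E (fps_X ^ Suc n) y"
      unfolding y(2) S by (simp add: R_def algebra_simps power2_eq_square)
    finally show ?case using y(1) by blast
  qed
  then obtain y where y: "\<And>n. y n \<in> pts E" "\<And>n. aop E (smult E S x) = R S + smult E (fps_X ^ n) (y n)"
    by metis
  have "representation B (y 0) c = 0" for c
  proof (rule fps_ext)
    fix n
    have "y 0 = smult E (fps_X ^ Suc n) (y (Suc n))" using y(2)[of 0] y(2)[of "Suc n"] by simp
    then have "representation B (y 0) c = fps_X ^ Suc n * representation B (y (Suc n)) c"
      using representation_scale B y(1) by metis
    then show "fps_nth (representation B (y 0) c) n = fps_nth 0 n"
      by (simp only: fps_X_power_mult_nth) simp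
  qed
  moreover have "(\<Sum>c\<in>B. smult E (representation B (y 0) c) c) = y 0"
    using B y(1) by (simp add: sum_representation_eq)
  ultimately have "y 0 = 0" by simp
  then show ?thesis using y(2)[of 0] by (simp add: R_def)
qed

lemma rank_one_aop:
  assumes "ab_module E" "e \<in> pts E" "aop E e = 0"
  shows "aop E (smult E S e) = smult E (fps_X\<^sup>2 * fps_deriv S) e"
proof -
  interpret module "smult E" using assms by (simp add: ab_module_def)
  show ?thesis using aop_smult[OF assms(1,2)] assms(3) by simp
qed

lemma module_adjoint: "module (smult (adjoint E))"
  by unfold_locales (simp_all add: adjoint_def fun_eq_iff algebra_simps)

lemma ab_module_adjoint:
  assumes E: "ab_module E"
  shows "ab_module (adjoint E)"
proof -
  interpret module "smult E" using E by (simp add: ab_module_def)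
  interpret A: module "smult (adjoint E)" by (rule module_adjoint)
  have zero: "0 \<in> pts E" and add: "\<And>x y. x \<in> pts E \<Longrightarrow> y \<in> pts E \<Longrightarrow> x + y \<in> pts E"
    and scale: "\<And>s x. x \<in> pts E \<Longrightarrow> smult E s x \<in> pts E"
    using E by (auto simp: ab_module_def subspace_def)
  have aE: "\<And>x. x \<in> pts E \<Longrightarrow> aop E x \<in> pts E"
    and aadd: "\<And>x y. x \<in> pts E \<Longrightarrow> y \<in> pts E \<Longrightarrow> aop E (x + y) = aop E x + aop E y"
    using E by (auto simp: ab_module_def)
  obtain B where B: "finite B" "\<not> dependent B" "span B = pts E"
    using E by (auto simp: ab_module_def)
  have sub: "A.subspace (pts (adjoint E))"
    unfolding A.subspace_def by (auto simp: adjoint_def fps_linear_def E0_def algebra_simps)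
  define d where "d = (\<lambda>c x. if x \<in> pts E then representation B x c else 0)"
  have d: "d c \<in> pts (adjoint E)" for c
    using B add scale
    by (auto simp: d_def adjoint_def fps_linear_def E0_def representation_add representation_scale)
  have dB: "d c c' = (if c = c' then 1 else 0)" if "c' \<in> B" for c c'
    using that B span_base[of c' B] by (simp add: d_def representation_basis)
  have sumev: "(\<Sum>c\<in>B. smult (adjoint E) (u c) (d c)) x = (\<Sum>c\<in>B. breve (u c) * d c x)" for u x
    by (induction B rule: infinite_finite_induct) (simp_all add: adjoint_def)
  have inj: "inj_on d B" by (rule inj_onI) (metis dB zero_neq_one)
  have ind: "\<not> A.dependent (d ` B)"
  proof -
    have "u (d c) = 0" if "(\<Sum>c\<in>B. smult (adjoint E) (u (d c)) (d c)) = 0" "c \<in> B" for u c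
    proof -
      have "0 = (\<Sum>c'\<in>B. breve (u (d c')) * d c' c)" using sumev[of "u \<circ> d" c] that by simp
      also have "\<dots> = breve (u (d c))"
        using that B(1) by (simp add: dB if_distrib[of "(*) _"] cong: if_cong)
      finally show ?thesis by simp
    qed
    then show ?thesis using B(1) inj by (subst A.dependent_finite) (auto simp: sum.reindex)
  qed
  have span: "A.span (d ` B) = pts (adjoint E)"
  proof
    show "A.span (d ` B) \<subseteq> pts (adjoint E)" by (rule A.span_minimal) (use d sub in auto)
    show "pts (adjoint E) \<subseteq> A.span (d ` B)"
    proof
      fix p assume p: "p \<in> pts (adjoint E)"
      have psum: "p (\<Sum>c\<in>C. smult E (r c) c) = (\<Sum>c\<in>C. r c * p c)" if "C \<subseteq> B" for C r
        using finite_subset[OF that B(1)] that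
      proof (induction C rule: finite_induct)
        case empty
        have "p (smult E 0 0) = 0 * p 0" 
          using p zero by (simp add: adjoint_def fps_linear_def E0_def del: scale_zero_left scale_zero_right)
        then show ?case by simp
      next
        case (insert c C)
        have "c \<in> pts E" "(\<Sum>c\<in>C. smult E (r c) c) \<in> pts E"
          using insert.prems B(3) span_base[of _ B] by (auto intro!: span_sum span_scale)
        then show ?case using insert p scale by (simp add: adjoint_def fps_linear_def E0_def)
      qed
      have "p x = (\<Sum>c\<in>B. smult (adjoint E) (breve (p c)) (d c)) x" for x
      proof (cases "x \<in> pts E")
        case True
        then have "(\<Sum>c\<in>B. smult E (representation B x c) c) = x"
          using B by (simp add: sum_representation_eq)
        then have "p x = (\<Sum>c\<in>B. representation B x c * p c)"
          using psum[of B "representation B x"] by simp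
        then show ?thesis by (simp add: sumev, simp add: d_def True mult.commute)
      next
        case False
        then show ?thesis using p by (simp add: sumev, simp add: d_def adjoint_def)
      qed
      then have "p = (\<Sum>c\<in>B. smult (adjoint E) (breve (p c)) (d c))" by (rule ext)
      moreover have "\<dots> \<in> A.span (d ` B)" by (intro A.span_sum A.span_scale A.span_base) auto
      ultimately show "p \<in> A.span (d ` B)" by simp
    qed
  qed
  have a_smult: "aop E (smult E s x) = smult E s (aop E x) + smult E (fps_X\<^sup>2 * fps_deriv s) x"
    if "x \<in> pts E" for s x
    using aop_smult[OF E that] .
  have "aop (adjoint E) p \<in> pts (adjoint E)" if "p \<in> pts (adjoint E)" for p
    using that add scale aE aadd
    by (auto simp: adjoint_def fps_linear_def E0_def a_smult algebra_simps)
  moreover have "aop (adjoint E) (bop (adjoint E) p) - bop (adjoint E) (aop (adjoint E) p) =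
      bop (adjoint E) (bop (adjoint E) p)" if "p \<in> pts (adjoint E)" for p
    using that aE
    by (auto simp: fun_eq_iff adjoint_def fps_linear_def E0_def algebra_simps power2_eq_square)
  ultimately show ?thesis
    unfolding ab_module_def using module_adjoint[of E] sub ind span B(1) aE
    by (auto simp: fun_eq_iff adjoint_def E0_def algebra_simps intro!: exI[of _ "d ` B"])
qed

lemma adjoint_map_hom:
  assumes E: "ab_module E" and f: "ab_hom E (adjoint E) f"
  shows "ab_hom E (adjoint E) (adjoint_map E f)"
proof -
  have "module.subspace (smult E) (pts E)" "module (smult E)" using E by (auto simp: ab_module_def)
  then have "\<And>x y. x \<in> pts E \<Longrightarrow> y \<in> pts E \<Longrightarrow> x + y \<in> pts E"
    "\<And>s x. x \<in> pts E \<Longrightarrow> smult E s x \<in> pts E"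
    by (auto simp: module.subspace_def)
  moreover have "\<And>x. x \<in> pts E \<Longrightarrow> aop E x \<in> pts E" using E by (auto simp: ab_module_def)
  ultimately show ?thesis using f breve_aop_E0
    by (auto simp: ab_hom_def fps_linear_def adjoint_def adjoint_map_def fun_eq_iff E0_def)
qed

lemma ab_iso_trans:
  assumes "ab_iso E F f" "ab_iso F G g" shows "ab_iso E G (g \<circ> f)"
  using assms by (auto simp: ab_iso_def ab_hom_def fps_linear_def intro: bij_betw_trans)

lemma regularI:
  fixes E :: "'v::ab_group_add ab_struct" and P :: "'w::ab_group_add ab_struct"
  assumes P: "simple_pole P" and W: "sub_ab_module P W" and f: "ab_iso E (P\<lparr>pts := W\<rparr>) f"
  shows "regular E"
proof -
  have PM: "ab_module P" using P by (simp add: simple_pole_def)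
  interpret module "smult P" using PM by (simp add: ab_module_def)
  define s :: "complex fps \<Rightarrow> (nat \<Rightarrow> complex fps) \<Rightarrow> nat \<Rightarrow> complex fps" where "s = (\<lambda>c u i. c * u i)"
  interpret N: module s by unfold_locales (simp_all add: s_def fun_eq_iff algebra_simps)
  obtain B where B: "finite B" "\<not> dependent B" "span B = pts P"
    using PM by (auto simp: ab_module_def)
  obtain h where h: "bij_betw h {..<card B} B"
    using ex_bij_betw_nat_finite[OF B(1)] by (auto simp: atLeast0LessThan)
  define g where "g x = (\<lambda>i. if i < card B then representation B x (h i) else 0)" for x
  have add: "\<And>x y. x \<in> pts P \<Longrightarrow> y \<in> pts P \<Longrightarrow> x + y \<in> pts P"
    and scale: "\<And>s x. x \<in> pts P \<Longrightarrow> smult P s x \<in> pts P" and zero: "0 \<in> pts P"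
    and aP: "\<And>x. x \<in> pts P \<Longrightarrow> aop P x \<in> pts P"
    using PM by (auto simp: ab_module_def subspace_def)
  have g_add: "g (x + y) = g x + g y" if "x \<in> pts P" "y \<in> pts P" for x y
    using that B by (simp add: g_def fun_eq_iff representation_add)
  have g_scale: "g (smult P c x) = s c (g x)" if "x \<in> pts P" for c x
    using that B by (simp add: g_def fun_eq_iff representation_scale s_def)
  have g_zero: "g 0 = 0" by (simp add: g_def fun_eq_iff representation_zero)
  have g0: "x = 0" if "x \<in> pts P" "g x = 0" for x
  proof -
    have "representation B x b = 0" if "b \<in> B" for b
    proof -
      obtain i where "i < card B" "h i = b" using h \<open>b \<in> B\<close> by (metis bij_betw_def imageE lessThan_iff)
      then show ?thesis using fun_cong[OF \<open>g x = 0\<close>, of i] by (simp add: g_def)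
    qed
    moreover have "(\<Sum>b\<in>B. smult P (representation B x b) b) = x"
      using B that by (simp add: sum_representation_eq)
    ultimately show ?thesis by simp
  qed
  have g_diff: "g (x - y) = g x - g y" if "x \<in> pts P" "y \<in> pts P" for x y
    using that B by (simp add: g_def fun_eq_iff representation_diff)
  have inj: "inj_on g (pts P)"
  proof (rule inj_onI)
    fix x y assume xy: "x \<in> pts P" "y \<in> pts P" "g x = g y"
    then have "x - y \<in> pts P" using B span_diff by metis
    then show "x = y" using g0[of "x - y"] xy by (simp add: g_diff)
  qed
  define g' where "g' = the_inv_into (pts P) g"
  have g': "g' (g x) = x" if "x \<in> pts P" for x
    using the_inv_into_f_f[OF inj that] by (simp add: g'_def)
  define Q where "Q = \<lparr>pts = g ` pts P, smult = s, aop = (\<lambda>u. g (aop P (g' u)))\<rparr>"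
  have aQ: "aop Q (g x) = g (aop P x)" if "x \<in> pts P" for x
    using that by (simp add: Q_def g')
  have sub: "N.subspace (g ` V)" if V: "subspace V" "V \<subseteq> pts P" for V
  proof -
    have "g x + g y \<in> g ` V" if "x \<in> V" "y \<in> V" for x y
      using that V g_add[of x y] subspace_add[OF V(1)] by (metis image_eqI subsetD)
    moreover have "s c (g x) \<in> g ` V" if "x \<in> V" for c x
      using that V g_scale[of x c] subspace_scale[OF V(1)] by (metis image_eqI subsetD)
    moreover have "0 \<in> g ` V" using subspace_0[OF V(1)] g_zero by (metis image_eqI)
    ultimately show ?thesis by (auto simp: N.subspace_def)
  qed
  have BP: "B \<subseteq> pts P" using B(3) span_superset by blast
  have g_sum: "g (\<Sum>b\<in>C. smult P (u b) b) = (\<Sum>b\<in>C. s (u b) (g b))" if "C \<subseteq> B" for C u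
    using finite_subset[OF that B(1)] that
  proof (induction C rule: finite_induct)
    case (insert c C)
    have "(\<Sum>b\<in>C. smult P (u b) b) \<in> pts P"
      unfolding B(3)[symmetric]
      by (intro span_sum span_scale span_base) (use insert.prems in auto)
    moreover have "c \<in> pts P" using insert.prems BP by auto
    ultimately show ?case using insert by (simp add: g_add g_scale scale)
  qed (simp add: g_zero)
  have "\<exists>B'. finite B' \<and> \<not> N.dependent B' \<and> N.span B' = g ` pts P"
  proof (intro exI conjI)
    show "finite (g ` B)" using B by simp
    have "u (g b) = 0" if "(\<Sum>b\<in>B. s (u (g b)) (g b)) = 0" "b \<in> B" for u b
    proof -
      have "(\<Sum>b\<in>B. smult P (u (g b)) b) \<in> pts P"
        unfolding B(3)[symmetric] by (intro span_sum span_scale span_base)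
      then have "(\<Sum>b\<in>B. smult P (u (g b)) b) = 0"
        using g0 g_sum[of B "u \<circ> g"] that by simp
      then show ?thesis
        using B(1,2) \<open>b \<in> B\<close> by (auto simp: dependent_finite dest: spec[of _ "u \<circ> g"])
    qed
    then show "\<not> N.dependent (g ` B)"
      using B(1) inj_on_subset[OF inj BP] by (subst N.dependent_finite) (auto simp: sum.reindex)
    show "N.span (g ` B) = g ` pts P"
    proof
      have "subspace (pts P)" using subspace_span[of B] B(3) by simp
      then show "N.span (g ` B) \<subseteq> g ` pts P"
        using BP by (intro N.span_minimal sub) auto
      show "g ` pts P \<subseteq> N.span (g ` B)"
      proof
        fix u assume "u \<in> g ` pts P"
        then obtain x where x: "x \<in> pts P" "u = g x" by blast
        have "(\<Sum>b\<in>B. smult P (representation B x b) b) = x"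
          using B x by (simp add: sum_representation_eq)
        then have "u = (\<Sum>b\<in>B. s (representation B x b) (g b))"
          using g_sum[of B "representation B x"] x by simp
        then show "u \<in> N.span (g ` B)" by (auto intro: N.span_sum N.span_scale N.span_base)
      qed
    qed
  qed
  moreover have "N.subspace (g ` pts P)" using sub[of "pts P"] subspace_span[of B] B(3) by simp
  moreover have "aop Q (g x + g y) = aop Q (g x) + aop Q (g y)" if "x \<in> pts P" "y \<in> pts P" for x y
    using that PM aP add by (simp flip: g_add add: aQ) (simp add: ab_module_def)
  moreover have "aop Q (s (fps_const c) (g x)) = s (fps_const c) (aop Q (g x))" if "x \<in> pts P" for c x
    using that PM aP scale by (simp flip: g_scale add: aQ) (simp add: ab_module_def)
  moreover have "aop Q (s fps_X (g x)) - s fps_X (aop Q (g x)) = s fps_X (s fps_X (g x))"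
    if "x \<in> pts P" for x
    using that PM aP scale by (simp flip: g_scale g_diff add: aQ) (simp add: ab_module_def)
  ultimately have QM: "ab_module Q"
    unfolding ab_module_def using N.module_axioms aP aQ by (auto simp: Q_def)
  have "aop Q ` pts Q \<subseteq> bop Q ` pts Q"
  proof
    fix u assume "u \<in> aop Q ` pts Q"
    then obtain x where x: "x \<in> pts P" "u = g (aop P x)" using aQ by (auto simp: Q_def)
    obtain y where "y \<in> pts P" "aop P x = bop P y" using P x by (auto simp: simple_pole_def)
    then show "u \<in> bop Q ` pts Q" using x g_scale by (auto simp: Q_def)
  qed
  then have "simple_pole Q" using QM by (simp add: simple_pole_def)
  have WP: "W \<subseteq> pts P" using W by (simp add: sub_ab_module_def)
  have "sub_ab_module Q (g ` W)"
    using W WP sub[of W] aQ by (auto simp: sub_ab_module_def Q_def)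
  have "ab_iso (P\<lparr>pts := W\<rparr>) (Q\<lparr>pts := g ` W\<rparr>) g"
    using WP g_add g_scale aQ inj
    by (auto simp: ab_iso_def ab_hom_def fps_linear_def Q_def subset_iff intro!: inj_on_imp_bij_betw
        elim: inj_on_subset)
  then have "ab_iso E (Q\<lparr>pts := g ` W\<rparr>) (g \<circ> f)" by (rule ab_iso_trans[OF f])
  with \<open>simple_pole Q\<close> \<open>sub_ab_module Q (g ` W)\<close> show ?thesis
    unfolding regular_def by (intro exI conjI)
qed

end

theory Submission
  imports Defs
begin

text \<open>
  The endomorphism ring of an indecomposable (a,b)-module is local. Indeed an endomorphism \<open>f\<close> is
  algebraic over \<open>\<complex>\<close>: its powers are linearly dependent over \<open>\<complex>[[b]]\<close>, and a Wronskian argument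
  makes the coefficients constant. Hence Fitting's lemma provides an idempotent endomorphism
  that is a polynomial in \<open>f\<close>; it must be \<open>0\<close> or \<open>1\<close>, so \<open>f\<close> is nilpotent or bijective.
  Given an isomorphism \<open>\<Phi>\<close> onto the adjoint, write \<open>\<Phi> = H + K\<close> with \<open>H\<close> hermitian and \<open>K\<close>
  anti-hermitian; since \<open>\<Phi>\<^sup>-\<^sup>1 H + \<Phi>\<^sup>-\<^sup>1 K = 1\<close>, one of \<open>H\<close> and \<open>K\<close> is an isomorphism.
\<close>

section \<open>Linear systems and Wronskians over power series\<close>

lemma exists_nontrivial_solution:
  fixes c :: "'j \<Rightarrow> 'i \<Rightarrow> 'a::idom"
  assumes "finite J" "finite I" "card J < card I"
  shows "\<exists>u. (\<exists>i\<in>I. u i \<noteq> 0) \<and> (\<forall>j\<in>J. (\<Sum>i\<in>I. c j i * u i) = 0)"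
  using assms
proof (induction J arbitrary: I c rule: finite_induct)
  case empty
  then have "I \<noteq> {}" by auto
  then show ?case by (intro exI[of _ "\<lambda>_. 1"]) auto
next
  case (insert j J)
  show ?case
  proof (cases "\<forall>i\<in>I. c j i = 0")
    case True
    have "card J < card I" using insert by simp
    from insert.IH[OF insert.prems(1) this, of c] show ?thesis using True by auto
  next
    case False
    then obtain p where p: "p \<in> I" "c j p \<noteq> 0" by blast
    define I' where "I' = I - {p}"
    have I: "I = insert p I'" "p \<notin> I'" "finite I'" using p insert.prems by (auto simp: I'_def)
    have "card J < card I'" using insert I by simp
    from insert.IH[OF I(3) this, of "\<lambda>k i. c j p * c k i - c k p * c j i"]
    obtain u where u: "\<exists>i\<in>I'. u i \<noteq> 0"
      "\<And>k. k \<in> J \<Longrightarrow> (\<Sum>i\<in>I'. (c j p * c k i - c k p * c j i) * u i) = 0" by blast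
    \<comment> \<open>Scaling the reduced solution by the pivot lets equation \<open>j\<close> be
      solved for the unknown \<open>p\<close> without a division.\<close>
    define v where "v i = (if i = p then - (\<Sum>i\<in>I'. c j i * u i) else c j p * u i)" for i
    have v: "(\<Sum>i\<in>I. c k i * v i) =
        (\<Sum>i\<in>I'. c k i * (c j p * u i)) - c k p * (\<Sum>i\<in>I'. c j i * u i)" for k
    proof -
      have "(\<Sum>i\<in>I'. c k i * v i) = (\<Sum>i\<in>I'. c k i * (c j p * u i))"
        by (rule sum.cong) (use I in \<open>auto simp: v_def\<close>)
      then show ?thesis using I by (simp add: v_def)
    qed
    have "(\<Sum>i\<in>I. c j i * v i) = 0"
      unfolding v by (simp add: sum_distrib_left mult.left_commute)
    moreover have "(\<Sum>i\<in>I. c k i * v i) = 0" if "k \<in> J" for k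
      using u(2)[OF that] unfolding v
      by (simp add: sum_distrib_left algebra_simps sum_subtractf)
    moreover have "\<exists>i\<in>I. v i \<noteq> 0" using u(1) p I by (auto simp: v_def)
    ultimately show ?thesis by (intro exI[of _ v]) auto
  qed
qed

lemma fps_dvd_linear: "s dvd t \<or> t dvd s" for s t :: "'a::field fps"
  by (metis fps_dvd_iff dvd_0_right linear)

text \<open>Divisibility of power series is total, so one of \<open>t / s\<close> and
  \<open>s / t\<close> is a power series \<open>r\<close>. The Wronskian is, up to sign, a square
  times \<open>fps_deriv r\<close>, and in characteristic 0 this forces \<open>r\<close> to be
  constant.\<close>

lemma fps_wronskian_eq_0:
  fixes s t :: "'a::field_char_0 fps"
  assumes "s \<noteq> 0" and W: "s * fps_deriv t = fps_deriv s * t"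
  shows "\<exists>c. t = fps_const c * s"
proof -
  have const: "r = fps_const (fps_nth r 0)" if "fps_deriv r = 0" for r :: "'a fps"
    using that by (simp add: fps_deriv_eq_0_iff)
  consider r where "t = s * r" | r where "s = t * r" using fps_dvd_linear[of s t] unfolding dvd_def by blast
  then show ?thesis
  proof cases
    case 1
    with W have "s * s * fps_deriv r = 0" by (simp add: algebra_simps)
    then have "fps_deriv r = 0" using assms by simp
    from const[OF this] 1 show ?thesis by (metis mult.commute)
  next
    case 2
    with W have "t * t * fps_deriv r = 0" by (simp add: algebra_simps)
    then have "fps_deriv r = 0" using assms 2 by simp
    from const[OF this] have r: "s = t * fps_const (fps_nth r 0)" using 2 by simp
    then have "fps_nth r 0 \<noteq> 0" using assms by auto
    then have "t = fps_const (inverse (fps_nth r 0)) * s"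
      by (subst r) (simp add: mult.left_commute[of _ t])
    then show ?thesis by blast
  qed
qed

section \<open>Linear algebra in a fixed (a,b)-module\<close>

locale ab_mod =
  fixes E :: "'v::ab_group_add ab_struct"
  assumes ab_module: "ab_module E"
begin

sublocale module "smult E" using ab_module by (simp add: ab_module_def)

abbreviation "endo \<equiv> ab_hom E E"

lemma subspace_pts: "subspace (pts E)" using ab_module by (simp add: ab_module_def)

lemmas zero_pts [simp, intro] = subspace_0[OF subspace_pts]
  and add_pts [simp, intro] = subspace_add[OF subspace_pts]
  and diff_pts [simp, intro] = subspace_diff[OF subspace_pts]
  and smult_pts [simp, intro] = subspace_scale[OF subspace_pts]
  and sum_pts [intro] = subspace_sum[OF subspace_pts]

lemma aop_pts [simp, intro]: "x \<in> pts E \<Longrightarrow> aop E x \<in> pts E"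
  and aop_add: "x \<in> pts E \<Longrightarrow> y \<in> pts E \<Longrightarrow> aop E (x + y) = aop E x + aop E y"
  and aop_const: "x \<in> pts E \<Longrightarrow> aop E (smult E (fps_const c) x) = smult E (fps_const c) (aop E x)"
  and aop_bop: "x \<in> pts E \<Longrightarrow> aop E (bop E x) - bop E (aop E x) = bop E (bop E x)"
  using ab_module unfolding ab_module_def by blast+

lemma aop_zero [simp]: "aop E 0 = 0"
  using aop_add[of 0 0] by simp

lemma aop_diff: "x \<in> pts E \<Longrightarrow> y \<in> pts E \<Longrightarrow> aop E (x - y) = aop E x - aop E y"
  using aop_add[of "x - y" y] by (simp add: algebra_simps)

lemma aop_sum: "(\<And>i. i \<in> I \<Longrightarrow> g i \<in> pts E) \<Longrightarrow> aop E (\<Sum>i\<in>I. g i) = (\<Sum>i\<in>I. aop E (g i))"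
  by (induction I rule: infinite_finite_induct) (auto simp: aop_add sum_pts)

lemma basisE:
  obtains B where "finite B" "independent B" "span B = pts E"
  using ab_module by (auto simp: ab_module_def)

text \<open>Coordinates in a basis reduce torsion-freeness to cancellation in
  \<open>complex fps\<close>.\<close>

lemma smult_eq_0:
  assumes "smult E s x = 0" "x \<in> pts E" "s \<noteq> 0"
  shows "x = 0"
proof -
  obtain B where B: "finite B" "independent B" "span B = pts E" by (rule basisE)
  have "s * representation B x b = 0" for b
    using fun_cong[OF representation_scale[of B x s], of b] assms B by (simp add: representation_zero)
  then have "representation B x b = 0" for b using assms by simp
  then show ?thesis
    using sum_representation_eq[of B x B] assms B by simp
qed

text \<open>A generating set of minimal size is a basis: in a relation a coefficient of minimal
  order divides all the others.\<close>

lemma finite_span_basis: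
  assumes "finite C" "C \<subseteq> pts E"
  shows "\<exists>B. finite B \<and> independent B \<and> span B = span C"
  using assms
proof (induction "card C" arbitrary: C rule: less_induct)
  case less
  show ?case
  proof (cases "independent C")
    case False
    then obtain u where u: "\<exists>v\<in>C. u v \<noteq> 0" "(\<Sum>v\<in>C. smult E (u v) v) = 0"
      using less.prems by (auto simp: dependent_finite)
    define p where "p = arg_min_on (\<lambda>v. subdegree (u v)) {v\<in>C. u v \<noteq> 0}"
    have fin: "finite {v\<in>C. u v \<noteq> 0}" "{v\<in>C. u v \<noteq> 0} \<noteq> {}" using less.prems u by auto
    have p: "p \<in> C" "u p \<noteq> 0" using arg_min_if_finite(1)[OF fin] by (auto simp: p_def)
    have "u p dvd u v" if "v \<in> C" for v
      using arg_min_least[OF fin, of v "\<lambda>v. subdegree (u v)"] p that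
      by (cases "u v = 0") (auto simp: p_def fps_dvd_iff)
    then have "\<forall>v\<in>C. \<exists>r. u v = u p * r" by (auto elim: dvdE)
    from bchoice[OF this] obtain t where t: "\<And>v. v \<in> C \<Longrightarrow> u v = u p * t v" by blast
    define y where "y = (\<Sum>v\<in>C - {p}. smult E (t v) v)"
    have "(\<Sum>v\<in>C. smult E (u v) v) = smult E (u p) (p + y)"
    proof -
      have "(\<Sum>v\<in>C - {p}. smult E (u v) v) = smult E (u p) y"
        unfolding y_def scale_sum_right by (rule sum.cong) (simp_all flip: t)
      then show ?thesis using less.prems p by (simp add: sum.remove scale_right_distrib)
    qed
    moreover have "y \<in> span (C - {p})"
      unfolding y_def by (intro span_sum span_scale span_base)
    moreover have "y \<in> pts E" unfolding y_def using less.prems by (intro sum_pts) auto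
    \<comment> \<open>Torsion-freeness cancels \<open>u p\<close>, which expresses the generator
      \<open>p\<close> through the others.\<close>
    ultimately have "p + y = 0" using smult_eq_0[of "u p" "p + y"] u p less.prems by auto
    then have "p = - y" by (simp add: eq_neg_iff_add_eq_0)
    then have "p \<in> span (C - {p})" using \<open>y \<in> span _\<close> span_neg by blast
    then have "C \<subseteq> span (C - {p})" using span_base[of _ "C - {p}"] by blast
    then have "span (C - {p}) = span C"
      by (intro subset_antisym span_mono Diff_subset span_minimal subspace_span)
    moreover have "card (C - {p}) < card C" using p less.prems by (intro card_Diff1_less)
    moreover have "finite (C - {p})" "C - {p} \<subseteq> pts E" using less.prems by auto
    ultimately show ?thesis using less.hyps[of "C - {p}"] by simp
  qed (use less.prems in auto)
qed

section \<open>Endomorphisms\<close>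

lemma endo_pts: "endo f \<Longrightarrow> x \<in> pts E \<Longrightarrow> f x \<in> pts E"
  and endo_add: "endo f \<Longrightarrow> x \<in> pts E \<Longrightarrow> y \<in> pts E \<Longrightarrow> f (x + y) = f x + f y"
  and endo_smult: "endo f \<Longrightarrow> x \<in> pts E \<Longrightarrow> f (smult E s x) = smult E s (f x)"
  and endo_aop: "endo f \<Longrightarrow> x \<in> pts E \<Longrightarrow> f (aop E x) = aop E (f x)"
  by (auto simp: ab_hom_def fps_linear_def)

lemma endo_zero: "endo f \<Longrightarrow> f 0 = 0"
  using endo_add[of f 0 0] by simp

lemma endo_diff: "endo f \<Longrightarrow> x \<in> pts E \<Longrightarrow> y \<in> pts E \<Longrightarrow> f (x - y) = f x - f y"
  using endo_add[of f "x - y" y] by (simp add: algebra_simps)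

lemma endo_sum:
  "endo f \<Longrightarrow> (\<And>i. i \<in> I \<Longrightarrow> g i \<in> pts E) \<Longrightarrow> f (\<Sum>i\<in>I. g i) = (\<Sum>i\<in>I. f (g i))"
  by (induction I rule: infinite_finite_induct) (auto simp: endo_add endo_zero sum_pts)

lemma endo_comp: "endo f \<Longrightarrow> endo g \<Longrightarrow> endo (\<lambda>x. f (g x))"
  by (auto simp: ab_hom_def fps_linear_def)

lemma endo_funpow: "endo f \<Longrightarrow> endo (f ^^ n)"
proof (induction n)
  case 0
  then show ?case by (simp add: ab_hom_def fps_linear_def)
next
  case (Suc n)
  then show ?case using endo_comp[of f "f ^^ n"] by (simp add: comp_def)
qed

lemma endo_id_minus:
  assumes f: "endo f"
  shows "endo (\<lambda>x. x - f x)"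
  unfolding ab_hom_def fps_linear_def
  by (auto simp: endo_pts[OF f] endo_add[OF f] endo_smult[OF f] endo_aop[OF f] aop_diff
      scale_right_diff_distrib)

text \<open>The coefficients are constants because multiplication by a general power series does not
  commute with \<open>a\<close>.\<close>

lemma endo_sum_const:
  assumes "\<And>i. i \<in> I \<Longrightarrow> endo (g i)"
  shows "endo (\<lambda>x. \<Sum>i\<in>I. smult E (fps_const (c i)) (g i x))"
  unfolding ab_hom_def fps_linear_def
  using assms
  by (auto simp: endo_add endo_smult endo_aop endo_pts aop_sum aop_const scale_right_distrib
      sum.distrib scale_sum_right mult.commute intro!: sum_pts sum.cong)

section \<open>Images and idempotents\<close>

text \<open>The image is generated by the images of a basis and lies in the torsion-free module
  \<open>E\<close>, so \<open>finite_span_basis\<close> makes it free. This is needed because the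
  summands in \<open>indecomposable\<close> must be free themselves.\<close>

lemma image_ab_module:
  assumes e: "endo e"
  shows "ab_module (E\<lparr>pts := e ` pts E\<rparr>)"
proof -
  obtain B where B: "finite B" "independent B" "span B = pts E" by (rule basisE)
  have BE: "B \<subseteq> pts E" using B(3) span_superset by blast
  have sub: "subspace (e ` pts E)"
    unfolding subspace_def using endo_add[OF e] endo_smult[OF e] endo_zero[OF e]
    by (auto simp: image_iff) (metis add_pts, metis smult_pts)
  have "span (e ` B) = e ` pts E"
  proof
    show "span (e ` B) \<subseteq> e ` pts E" using BE sub by (intro span_minimal) auto
    show "e ` pts E \<subseteq> span (e ` B)"
    proof safe
      fix x assume "x \<in> pts E"
      then have "x = (\<Sum>b\<in>B. smult E (representation B x b) b)"
        using B by (simp add: sum_representation_eq)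
      then have "e x = (\<Sum>b\<in>B. smult E (representation B x b) (e b))"
        using BE endo_sum[OF e, of B "\<lambda>b. smult E (representation B x b) b"]
        by (simp add: endo_smult[OF e] subset_iff)
      then show "e x \<in> span (e ` B)" by (auto intro: span_sum span_scale span_base)
    qed
  qed
  moreover have aop_e: "aop E (e x) \<in> e ` pts E" if "x \<in> pts E" for x
    using that endo_aop[OF e, symmetric] by auto
  moreover have "e ` B \<subseteq> pts E" using BE endo_pts[OF e] by auto
  ultimately obtain C where "finite C" "independent C" "span C = e ` pts E"
    using finite_span_basis[of "e ` B"] B by auto
  then show ?thesis
    using module_axioms sub endo_pts[OF e] aop_e aop_add aop_const aop_bop
    unfolding ab_module_def by (auto simp del: scale_scale)
qed

text \<open>An idempotent splits \<open>E\<close> into the images of \<open>e\<close> and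
  \<open>1 - e\<close>, and indecomposability makes one of them zero.\<close>

lemma idempotent_trivial:
  assumes ind: "indecomposable E" and e: "endo e" and idem: "\<And>x. x \<in> pts E \<Longrightarrow> e (e x) = e x"
  shows "(\<forall>x\<in>pts E. e x = 0) \<or> (\<forall>x\<in>pts E. e x = x)"
proof -
  define F G where "F = e ` pts E" and "G = (\<lambda>x. x - e x) ` pts E"
  note e' = endo_id_minus[OF e]
  have "F \<subseteq> pts E" "G \<subseteq> pts E" using endo_pts[OF e] endo_pts[OF e'] by (auto simp: F_def G_def)
  moreover have "ab_module (E\<lparr>pts := F\<rparr>)" "ab_module (E\<lparr>pts := G\<rparr>)"
    unfolding F_def G_def by (rule image_ab_module, fact)+
  moreover have "F \<inter> G = {0}"
  proof
    have eF: "e y = y" if "y \<in> F" for y using that idem by (auto simp: F_def)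
    have eG: "e y = 0" if "y \<in> G" for y
      using that idem endo_diff[OF e] endo_pts[OF e] by (auto simp: G_def)
    show "F \<inter> G \<subseteq> {0}" using eF eG by fastforce
    have "0 \<in> F" "0 \<in> G" using endo_zero[OF e] by (auto simp: F_def G_def image_iff intro!: bexI[of _ 0])
    then show "{0} \<subseteq> F \<inter> G" by simp
  qed
  moreover have "pts E = {x + y | x y. x \<in> F \<and> y \<in> G}"
  proof safe
    fix x assume "x \<in> pts E"
    then show "\<exists>x' y. x = x' + y \<and> x' \<in> F \<and> y \<in> G"
      by (intro exI[of _ "e x"] exI[of _ "x - e x"]) (auto simp: F_def G_def)
  qed (use \<open>F \<subseteq> pts E\<close> \<open>G \<subseteq> pts E\<close> in auto)
  ultimately have "F = {0} \<or> G = {0}"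
    using ind unfolding indecomposable_def by blast
  then show ?thesis
  proof
    assume "F = {0}"
    then have "e x = 0" if "x \<in> pts E" for x using that unfolding F_def by blast
    then show ?thesis by blast
  next
    assume "G = {0}"
    then have "x - e x = 0" if "x \<in> pts E" for x using that unfolding G_def by blast
    then show ?thesis by simp
  qed
qed

section \<open>Polynomial relations satisfied by an endomorphism\<close>

text \<open>The bound \<open>m\<close> is only a formal degree: \<open>s m\<close> may vanish, and
  the values of \<open>s\<close> beyond \<open>m\<close> are irrelevant.\<close>

definition annihilates :: "('v \<Rightarrow> 'v) \<Rightarrow> nat \<Rightarrow> (nat \<Rightarrow> complex fps) \<Rightarrow> bool" where
  "annihilates f m s \<longleftrightarrow> (\<forall>x\<in>pts E. (\<Sum>i\<le>m. smult E (s i) ((f ^^ i) x)) = 0)"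

text \<open>Dropping the vanishing top coefficients turns the formal degree into the true one, so
  that relations can be compared with one of minimal degree.\<close>

lemma annihilates_truncate:
  assumes "annihilates f n s" "s i \<noteq> 0" "i \<le> n"
  shows "\<exists>m\<le>n. s m \<noteq> 0 \<and> annihilates f m s"
proof -
  define m where "m = Max {i. i \<le> n \<and> s i \<noteq> 0}"
  have fin: "finite {i. i \<le> n \<and> s i \<noteq> 0}" by simp
  have m: "m \<le> n" "s m \<noteq> 0" using Max_in[OF fin] assms unfolding m_def by blast+
  have top: "s j = 0" if "j \<le> n" "m < j" for j
  proof (rule ccontr)
    assume "s j \<noteq> 0"
    then have "j \<le> m" unfolding m_def using that by (intro Max_ge[OF fin]) simp
    then show False using that by simp
  qed
  have "(\<Sum>i\<le>m. smult E (s i) ((f ^^ i) x)) = (\<Sum>i\<le>n. smult E (s i) ((f ^^ i) x))" for x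
    by (rule sum.mono_neutral_left) (use m top in auto)
  then show ?thesis using assms m by (auto simp: annihilates_def)
qed

text \<open>In a basis of r elements the powers of \<open>f\<close> are r by r matrices, so any r^2
  + 1 of them are linearly dependent over \<open>complex fps\<close>.\<close>

lemma annihilates_exists:
  assumes f: "endo f"
  shows "\<exists>m s. s m \<noteq> 0 \<and> annihilates f m s"
proof -
  obtain B where B: "finite B" "independent B" "span B = pts E" by (rule basisE)
  have BE: "B \<subseteq> pts E" using B(3) span_superset by blast
  define n where "n = card (B \<times> B)"
  note fp = endo_funpow[OF f]
  obtain s where s: "\<exists>i\<in>{..n}. s i \<noteq> 0"
    "\<And>b c. b \<in> B \<Longrightarrow> c \<in> B \<Longrightarrow> (\<Sum>i\<le>n. representation B ((f ^^ i) b) c * s i) = 0"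
    \<comment> \<open>There is one equation per matrix entry; \<open>{..n}\<close> supplies one
      unknown more than that.\<close>
    using exists_nontrivial_solution[of "B \<times> B" "{..n}"
        "\<lambda>(b, c) i. representation B ((f ^^ i) b) c"] B(1) by (auto simp: n_def)
  have zero: "(\<Sum>i\<le>n. smult E (s i) ((f ^^ i) b)) = 0" if b: "b \<in> B" for b
  proof -
    have "(\<Sum>i\<le>n. smult E (s i) ((f ^^ i) b)) =
        (\<Sum>i\<le>n. smult E (s i) (\<Sum>c\<in>B. smult E (representation B ((f ^^ i) b) c) c))"
      using B b BE endo_pts[OF fp] by (intro sum.cong) (auto simp: sum_representation_eq)
    also have "\<dots> = (\<Sum>c\<in>B. smult E (\<Sum>i\<le>n. representation B ((f ^^ i) b) c * s i) c)"
      unfolding scale_sum_right scale_sum_left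
      by (subst sum.swap) (simp add: mult.commute)
    also have "\<dots> = 0" using s(2) b by simp
    finally show ?thesis .
  qed
  have "annihilates f n s"
    unfolding annihilates_def
  proof
    fix x assume x: "x \<in> pts E"
    define r where "r = representation B x"
    have "x = (\<Sum>b\<in>B. smult E (r b) b)"
      using B x by (simp add: sum_representation_eq r_def)
    then have "(f ^^ i) x = (\<Sum>b\<in>B. smult E (r b) ((f ^^ i) b))" for i
      using BE endo_sum[OF fp, of B "\<lambda>b. smult E (r b) b"]
      by (simp add: endo_smult[OF fp] subset_iff)
    then have "(\<Sum>i\<le>n. smult E (s i) ((f ^^ i) x)) =
        (\<Sum>b\<in>B. smult E (r b) (\<Sum>i\<le>n. smult E (s i) ((f ^^ i) b)))"
      unfolding scale_sum_right by (subst sum.swap) (simp add: scale_sum_right mult.commute)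
    then show "(\<Sum>i\<le>n. smult E (s i) ((f ^^ i) x)) = 0" by (simp add: zero)
  qed
  then show ?thesis using annihilates_truncate s(1) by blast
qed

text \<open>Commuting a relation of minimal degree \<open>\<Sum> s\<^sub>i f\<^sup>i = 0\<close> with \<open>a\<close> yields the relation
  \<open>\<Sum> b\<^sup>2 s\<^sub>i' f\<^sup>i = 0\<close>; by minimality the two are proportional, so every \<open>s\<^sub>i / s\<^sub>m\<close> is a constant.\<close>

lemma const_annihilates_exists:
  assumes f: "endo f"
  shows "\<exists>m c. c m \<noteq> 0 \<and> annihilates f m (\<lambda>i. fps_const (c i))"
proof -
  note fp = endo_funpow[OF f]
  define m where "m = (LEAST m. \<exists>s. s m \<noteq> 0 \<and> annihilates f m s)"
  obtain s where s: "s m \<noteq> 0" "annihilates f m s"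
    using LeastI_ex[OF annihilates_exists[OF f]] by (auto simp: m_def)
  \<comment> \<open>The Wronskian of \<open>s m\<close> and \<open>s i\<close>: cross-multiplying
    the differentiated relation with the original one makes the coefficient of index
    \<open>m\<close> vanish.\<close>
  define u where "u i = s m * fps_deriv (s i) - fps_deriv (s m) * s i" for i
  have "annihilates f m u"
    unfolding annihilates_def
  proof
    fix x assume x: "x \<in> pts E"
    define R where "R t x = (\<Sum>i\<le>m. smult E (t i) ((f ^^ i) x))" for t x
    have R0: "R s y = 0" if "y \<in> pts E" for y using that s(2) by (simp add: annihilates_def R_def)
    have "0 = aop E (R s x)" using R0[OF x] by simp
    also have "\<dots> = (\<Sum>i\<le>m. aop E (smult E (s i) ((f ^^ i) x)))"
      unfolding R_def using endo_pts[OF fp x] by (intro aop_sum) auto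
    also have "\<dots> = R s (aop E x) + R (\<lambda>i. fps_X\<^sup>2 * fps_deriv (s i)) x"
      using x endo_pts[OF fp x] endo_aop[OF fp x]
      by (simp add: R_def aop_smult[OF ab_module] sum.distrib)
    finally have R1: "R (\<lambda>i. fps_X\<^sup>2 * fps_deriv (s i)) x = 0" using R0 x by simp
    have "smult E (fps_X\<^sup>2) (R u x) =
        smult E (s m) (R (\<lambda>i. fps_X\<^sup>2 * fps_deriv (s i)) x) - smult E (fps_X\<^sup>2 * fps_deriv (s m)) (R s x)"
      by (simp add: R_def u_def scale_sum_right flip: sum_subtractf scale_left_diff_distrib)
        (simp add: algebra_simps)
    then have "smult E (fps_X\<^sup>2) (R u x) = 0" by (simp add: R0 R1 x)
    moreover have "R u x \<in> pts E" unfolding R_def using endo_pts[OF fp x] by (intro sum_pts) auto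
    ultimately show "(\<Sum>i\<le>m. smult E (u i) ((f ^^ i) x)) = 0"
      using smult_eq_0[of "fps_X\<^sup>2" "R u x"] by (simp add: R_def)
  qed
  \<comment> \<open>A nonzero \<open>u i\<close> would give a relation of true degree
    \<open>k \<le> m\<close>. Minimality forces \<open>k = m\<close>, but
    \<open>u m = 0\<close>.\<close>
  have "u i = 0" if "i \<le> m" for i
  proof (rule ccontr)
    assume "u i \<noteq> 0"
    from annihilates_truncate[OF \<open>annihilates f m u\<close> this that]
    obtain k where k: "k \<le> m" "u k \<noteq> 0" "annihilates f k u" by (elim exE conjE)
    have "m \<le> k"
      unfolding m_def by (intro Least_le exI[of _ u] conjI k)
    then show False using k by (simp add: u_def)
  qed
  then have "\<forall>i\<in>{..m}. \<exists>c. s i = fps_const c * s m"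
    using s(1) by (intro ballI fps_wronskian_eq_0) (auto simp: u_def)
  from bchoice[OF this] obtain c where c: "\<And>i. i \<le> m \<Longrightarrow> s i = fps_const (c i) * s m" by auto
  have "annihilates f m (\<lambda>i. fps_const (c i))"
    unfolding annihilates_def
  proof
    fix x assume x: "x \<in> pts E"
    have "smult E (s m) (\<Sum>i\<le>m. smult E (fps_const (c i)) ((f ^^ i) x)) =
        (\<Sum>i\<le>m. smult E (s i) ((f ^^ i) x))"
      unfolding scale_sum_right by (rule sum.cong) (simp_all add: mult.commute[of "s m"] flip: c)
    also have "\<dots> = 0" using s(2) x by (simp add: annihilates_def)
    finally show "(\<Sum>i\<le>m. smult E (fps_const (c i)) ((f ^^ i) x)) = 0"
      by (rule smult_eq_0[OF _ _ s(1)]) (intro sum_pts smult_pts endo_pts[OF fp x])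
  qed
  moreover have "fps_const (c m) * s m \<noteq> 0" unfolding c[OF order_refl, symmetric] by (rule s(1))
  then have "c m \<noteq> 0" by auto
  ultimately show ?thesis by blast
qed

text \<open>Fitting's lemma in the commutative algebra \<open>\<complex>[f]\<close>: solving the relation for its term of
  lowest degree.\<close>

lemma funpow_eq_funpow_Suc_comp:
  assumes f: "endo f"
  shows "\<exists>k w. endo w \<and> (\<forall>x\<in>pts E. f (w x) = w (f x)) \<and> (\<forall>x\<in>pts E. (f ^^ k) x = (f ^^ Suc k) (w x))"
proof -
  note fp = endo_funpow[OF f]
  obtain m c where c: "c m \<noteq> 0" "annihilates f m (\<lambda>i. fps_const (c i))"
    using const_annihilates_exists[OF f] by blast
  define k where "k = (LEAST k. c k \<noteq> 0)"
  have k: "c k \<noteq> 0" "k \<le> m" 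
    using c(1) LeastI[of "\<lambda>k. c k \<noteq> 0" m] Least_le[of "\<lambda>k. c k \<noteq> 0" m] by (auto simp: k_def)
  have low: "c i = 0" if "i < k" for i using not_less_Least[of i "\<lambda>k. c k \<noteq> 0"] that by (auto simp: k_def)
  \<comment> \<open>Dividing the relation by \<open>c k\<close> and factoring
    \<open>f ^^ Suc k\<close> out of all higher terms leaves this polynomial in \<open>f\<close>. If
    \<open>k = m\<close> the sum is empty, \<open>w = 0\<close>, and \<open>f\<close> is
    nilpotent.\<close>
  define w where "w x = (\<Sum>i<m - k. smult E (fps_const (- c (Suc (k + i)) / c k)) ((f ^^ i) x))" for x
  have w: "endo w" unfolding w_def using fp by (intro endo_sum_const)
  moreover have "f (w x) = w (f x)" if "x \<in> pts E" for x
    using endo_sum[OF f, of "{..<m - k}" "\<lambda>i. smult E (fps_const (- c (Suc (k + i)) / c k)) ((f ^^ i) x)"]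
      endo_pts[OF fp that]
    by (simp add: w_def endo_smult[OF f] funpow_swap1)
  moreover have "(f ^^ k) x = (f ^^ Suc k) (w x)" if x: "x \<in> pts E" for x
  proof -
    define g where "g i = smult E (fps_const (c i)) ((f ^^ i) x)" for i
    have "0 = (\<Sum>i\<le>m. g i)" using c(2) x by (simp add: annihilates_def g_def)
    also have "\<dots> = (\<Sum>i\<in>{k..m}. g i)"
      by (rule sum.mono_neutral_right) (use low in \<open>auto simp: g_def\<close>)
    also have "\<dots> = g k + (\<Sum>i\<in>{Suc k..m}. g i)"
      using k(2) by (rule sum.atLeast_Suc_atMost)
    also have "(\<Sum>i\<in>{Suc k..m}. g i) = (\<Sum>i<m - k. g (Suc (k + i)))"
      by (rule sum.reindex_bij_witness[of _ "\<lambda>i. Suc (k + i)" "\<lambda>i. i - Suc k"]) auto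
    finally have g: "g k = - (\<Sum>i<m - k. g (Suc (k + i)))" by (simp add: eq_neg_iff_add_eq_0)
    have "(f ^^ Suc k) (w x) = (\<Sum>i<m - k. smult E (fps_const (- c (Suc (k + i)) / c k)) ((f ^^ Suc (k + i)) x))"
      unfolding w_def
      by (subst endo_sum[OF fp]) (use endo_pts[OF fp x] in
          \<open>auto simp: endo_smult[OF fp] funpow_add simp del: funpow.simps simp flip: add_Suc\<close>)
    also have "\<dots> = smult E (fps_const (1 / c k)) (- (\<Sum>i<m - k. g (Suc (k + i))))"
      by (simp add: g_def scale_sum_right field_simps flip: sum_negf scale_minus_left del: funpow.simps)
    also have "\<dots> = (f ^^ k) x"
      unfolding g[symmetric] using k(1) by (simp add: g_def)
    finally show ?thesis ..
  qed
  ultimately show ?thesis by blast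
qed

section \<open>Locality of the endomorphism ring\<close>

text \<open>The idempotent attached to \<open>f\<close> is \<open>f^n w^n\<close>. If it is 0, then
  \<open>f\<close> is nilpotent and \<open>1 - f\<close> is inverted by a geometric sum; if it is 1,
  then \<open>f\<close> is invertible.\<close>

lemma endo_local:
  assumes ind: "indecomposable E" and f: "endo f"
  shows "bij_betw f (pts E) (pts E) \<or> bij_betw (\<lambda>x. x - f x) (pts E) (pts E)"
proof -
  note fp = endo_funpow[OF f]
  note [simp] = endo_pts[OF f] endo_pts[OF fp]
  obtain k w where w: "endo w" and fw: "\<forall>x\<in>pts E. f (w x) = w (f x)"
    and kw: "\<forall>x\<in>pts E. (f ^^ k) x = (f ^^ Suc k) (w x)"
    using funpow_eq_funpow_Suc_comp[OF f] by (elim exE conjE)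
  \<comment> \<open>Taking \<open>Suc k\<close> instead of \<open>k\<close> makes the exponent
    positive, so that one factor \<open>f\<close> can be split off when \<open>e\<close> is the
    identity.\<close>
  define n where "n = Suc k"
  note wp = endo_funpow[OF w]
  note [simp] = endo_pts[OF w] endo_pts[OF wp]
  have nw: "(f ^^ n) x = (f ^^ Suc n) (w x)" if "x \<in> pts E" for x
    using kw that by (simp add: n_def)
  have fwn: "f ((w ^^ j) x) = (w ^^ j) (f x)" if "x \<in> pts E" for x j
    using that by (induction j) (auto simp: fw)
  have comm: "(f ^^ i) ((w ^^ j) x) = (w ^^ j) ((f ^^ i) x)" if "x \<in> pts E" for x i j
    using that by (induction i) (auto simp: fwn)
  \<comment> \<open>Iterating \<open>f^n = f^(n+1) w\<close> gives \<open>f^n = f^(n+j) w^j\<close>;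
    the case \<open>j = n\<close> says \<open>f^n e = f^n\<close>, from which idempotence
    follows.\<close>
  have pow: "(f ^^ n) x = (f ^^ j) ((f ^^ n) ((w ^^ j) x))" if "x \<in> pts E" for x j
  proof (induction j)
    case (Suc j)
    have "(f ^^ n) ((w ^^ j) x) = f ((f ^^ n) ((w ^^ Suc j) x))" using that nw[of "(w ^^ j) x"] by simp
    then show ?case using Suc by (simp add: funpow_swap1)
  qed simp
  define e where "e x = (f ^^ n) ((w ^^ n) x)" for x
  have fe: "(f ^^ n) (e x) = (f ^^ n) x" if "x \<in> pts E" for x
    unfolding e_def using pow[OF that, of n] by simp
  have "endo e" unfolding e_def by (rule endo_comp[OF fp wp])
  moreover have "e (e x) = e x" if "x \<in> pts E" for x
  proof -
    have "e (e x) = (w ^^ n) ((f ^^ n) (e x))" unfolding e_def[of "e x"]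
      using that by (subst comm) (auto simp: e_def)
    also have "\<dots> = e x" unfolding fe[OF that] using that by (simp add: e_def comm)
    finally show ?thesis .
  qed
  ultimately consider "\<And>x. x \<in> pts E \<Longrightarrow> e x = 0" | "\<And>x. x \<in> pts E \<Longrightarrow> e x = x"
    using idempotent_trivial[OF ind] by blast
  then show ?thesis
  proof cases
    case 1
    then have nil: "(f ^^ n) x = 0" if "x \<in> pts E" for x
      using fe[OF that] that endo_zero[OF fp] by simp
    have "inj_on (\<lambda>x. x - f x) (pts E)"
    proof (rule inj_onI)
      fix x y assume xy: "x \<in> pts E" "y \<in> pts E" "x - f x = y - f y"
      \<comment> \<open>A vector fixed by \<open>f\<close> is fixed by every power of
        \<open>f\<close>, hence is zero by nilpotency.\<close>
      then have fix1: "f (x - y) = x - y" by (simp add: endo_diff[OF f] algebra_simps)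
      have "(f ^^ j) (x - y) = x - y" for j by (induction j) (auto simp: fix1)
      then show "x = y" using nil[of "x - y"] xy by simp
    qed
    moreover have "y \<in> (\<lambda>x. x - f x) ` pts E" if "y \<in> pts E" for y
    proof
      define z where "z = (\<Sum>i<n. (f ^^ i) y)"
      show "z \<in> pts E" unfolding z_def using that by (intro sum_pts) auto
      have "f z = (\<Sum>i<n. (f ^^ Suc i) y)" unfolding z_def using that by (simp add: endo_sum[OF f])
      then have "z - f z = (\<Sum>i<n. (f ^^ i) y - (f ^^ Suc i) y)" by (simp add: z_def sum_subtractf)
      also have "\<dots> = y" using nil[OF that] by (subst sum_lessThan_telescope') simp
      finally show "y = z - f z" ..
    qed
    ultimately show ?thesis using endo_pts[OF endo_id_minus[OF f]] by (auto simp: bij_betw_def)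
  next
    case 2
    \<comment> \<open>With \<open>e = 1\<close>, the map \<open>f^k w^n\<close> is a right inverse
      of \<open>f\<close>; it is also a left inverse because \<open>w\<close> commutes with
      \<open>f\<close>.\<close>
    have fg: "f ((f ^^ k) ((w ^^ n) x)) = x" if "x \<in> pts E" for x
      using 2[OF that] by (simp add: e_def n_def)
    have "bij_betw f (pts E) (pts E)"
    proof (rule bij_betw_byWitness[where f' = "\<lambda>x. (f ^^ k) ((w ^^ n) x)"])
      show "\<forall>x\<in>pts E. (f ^^ k) ((w ^^ n) (f x)) = x"
      proof
        fix x assume x: "x \<in> pts E"
        have "(f ^^ k) ((w ^^ n) (f x)) = (f ^^ k) (f ((w ^^ n) x))" using fwn[OF x] by simp
        also have "\<dots> = f ((f ^^ k) ((w ^^ n) x))" by (rule funpow_swap1[symmetric])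
        finally show "(f ^^ k) ((w ^^ n) (f x)) = x" using fg[OF x] by simp
      qed
    qed (use fg in auto)
    then show ?thesis ..
  qed
qed

end

section \<open>Hermitian and anti-hermitian parts of an isomorphism onto the adjoint\<close>

theorem theorem30:
  fixes E :: "'v::ab_group_add ab_struct"
  assumes "ab_module E"
    and "pts E \<noteq> {0}"
    and "regular E"
    and "indecomposable E"
    and "self_adjoint E"
  shows "(\<exists>\<Phi>. nondegenerate_form E \<Phi> \<and> ab_hermitian E \<Phi>) \<or>
         (\<exists>\<Phi>. nondegenerate_form E \<Phi> \<and> anti_ab_hermitian E \<Phi>)"
proof -
  interpret ab_mod E by standard fact
  let ?A = "adjoint E"
  interpret A: ab_mod ?A by standard (rule ab_module_adjoint, fact)
  obtain \<Phi> where \<Phi>: "ab_iso E ?A \<Phi>" using assms by (auto simp: self_adjoint_def)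
  then have hom: "ab_hom E ?A \<Phi>" and bij: "bij_betw \<Phi> (pts E) (pts ?A)" by (auto simp: ab_iso_def)
  note hom' = adjoint_map_hom[OF assms(1) hom]
  \<comment> \<open>For \<open>t = 1\<close> this is the hermitian part of \<Phi>, for
    \<open>t = - 1\<close> the anti-hermitian part. Constants are fixed by \<open>breve\<close>, so
    the halves act as ordinary scalars.\<close>
  define \<epsilon> where "\<epsilon> t v = smult ?A (fps_const (1 / 2)) (\<Phi> v) + smult ?A (fps_const (t / 2)) (adjoint_map E \<Phi> v)"
    for t v
  have \<epsilon>_hom: "ab_hom E ?A (\<epsilon> t)" for t
    using hom hom' unfolding ab_hom_def fps_linear_def \<epsilon>_def
    by (auto simp: A.aop_add A.aop_const A.scale_right_distrib mult.commute)
  define \<Psi> where "\<Psi> = the_inv_into (pts E) \<Phi>"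
  have \<Psi>\<Phi>: "\<Psi> (\<Phi> x) = x" if "x \<in> pts E" for x
    using the_inv_into_f_f[OF bij_betw_imp_inj_on[OF bij] that] by (simp add: \<Psi>_def)
  have \<Phi>\<Psi>: "\<Phi> (\<Psi> p) = p" and \<Psi>_pts: "\<Psi> p \<in> pts E" if "p \<in> pts ?A" for p
    using f_the_inv_into_f_bij_betw[OF bij] bij_betw_the_inv_into[OF bij] that
    by (auto simp: \<Psi>_def bij_betw_def)
  have \<Psi>_hom: "ab_hom ?A E \<Psi>"
  proof -
    have "\<Psi> (p + q) = \<Psi> p + \<Psi> q" if "p \<in> pts ?A" "q \<in> pts ?A" for p q
      using \<Psi>\<Phi>[of "\<Psi> p + \<Psi> q"] hom that by (simp add: \<Phi>\<Psi> \<Psi>_pts ab_hom_def fps_linear_def)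
    moreover have "\<Psi> (smult ?A s p) = smult E s (\<Psi> p)" if "p \<in> pts ?A" for p s
      using \<Psi>\<Phi>[of "smult E s (\<Psi> p)"] hom that by (simp add: \<Phi>\<Psi> \<Psi>_pts ab_hom_def fps_linear_def)
    moreover have "\<Psi> (aop ?A p) = aop E (\<Psi> p)" if "p \<in> pts ?A" for p
      using \<Psi>\<Phi>[of "aop E (\<Psi> p)"] hom that by (simp add: \<Phi>\<Psi> \<Psi>_pts ab_hom_def)
    ultimately show ?thesis using \<Psi>_pts by (simp add: ab_hom_def fps_linear_def)
  qed
  have \<epsilon>_pts: "\<epsilon> t x \<in> pts ?A" if "x \<in> pts E" for t x
    using \<epsilon>_hom that by (simp add: ab_hom_def fps_linear_def)
  \<comment> \<open>Composing with the bijection \<Phi> recovers \<epsilon> from the endomorphism,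
    so bijectivity can be tested inside \<open>E\<close>.\<close>
  have nondeg: "nondegenerate_form E (\<epsilon> t)" if "bij_betw (\<lambda>x. \<Psi> (\<epsilon> t x)) (pts E) (pts E)" for t
  proof -
    have "bij_betw (\<Phi> \<circ> (\<lambda>x. \<Psi> (\<epsilon> t x))) (pts E) (pts ?A)"
      by (rule bij_betw_trans[OF that bij])
    then have "bij_betw (\<epsilon> t) (pts E) (pts ?A)"
      by (rule bij_betw_cong[THEN iffD1, rotated]) (simp add: \<Phi>\<Psi> \<epsilon>_pts)
    then show ?thesis using \<epsilon>_hom by (simp add: nondegenerate_form_def ab_iso_def)
  qed
  have "ab_hom E E (\<lambda>x. \<Psi> (\<epsilon> 1 x))"
    using \<Psi>_hom \<epsilon>_hom by (simp add: ab_hom_def fps_linear_def)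
  from endo_local[OF assms(4) this]
  have "nondegenerate_form E (\<epsilon> 1) \<or> nondegenerate_form E (\<epsilon> (- 1))"
  proof
    assume bij': "bij_betw (\<lambda>x. x - \<Psi> (\<epsilon> 1 x)) (pts E) (pts E)"
    \<comment> \<open>The two parts add up to \<Phi>, so the endomorphisms obtained from them add up
      to the identity, as \<open>endo_local\<close> requires.\<close>
    have "x - \<Psi> (\<epsilon> 1 x) = \<Psi> (\<epsilon> (- 1) x)" if x: "x \<in> pts E" for x
    proof -
      have "\<epsilon> 1 x + \<epsilon> (- 1) x =
          smult ?A (fps_const (1 / 2) + fps_const (1 / 2)) (\<Phi> x) +
          smult ?A (fps_const (1 / 2) + fps_const (- 1 / 2)) (adjoint_map E \<Phi> x)"
        unfolding \<epsilon>_def A.scale_left_distrib by (simp only: ac_simps)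
      then have "\<epsilon> 1 x + \<epsilon> (- 1) x = \<Phi> x" by simp
      then have "x = \<Psi> (\<epsilon> 1 x + \<epsilon> (- 1) x)" using \<Psi>\<Phi> x by simp
      also have "\<dots> = \<Psi> (\<epsilon> 1 x) + \<Psi> (\<epsilon> (- 1) x)"
        using \<Psi>_hom \<epsilon>_pts x by (simp add: ab_hom_def fps_linear_def)
      finally show ?thesis by (simp add: algebra_simps)
    qed
    then have "bij_betw (\<lambda>x. \<Psi> (\<epsilon> (- 1) x)) (pts E) (pts E)"
      by (intro bij_betw_cong[THEN iffD1, OF _ bij']) auto
    then show ?thesis using nondeg by blast
  qed (use nondeg in blast)
  \<comment> \<open>The symmetry conditions equate functions on the whole type, so values outside
    the carrier must be compared too; there \<open>adjoint_map\<close> is 0 by definition and \<Phi>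
    by membership in the adjoint.\<close>
  moreover have out: "\<Phi> v w = 0" if "v \<in> pts E" "w \<notin> pts E" for v w
    using hom that by (simp add: ab_hom_def fps_linear_def adjoint_def)
  have "ab_hermitian E (\<epsilon> 1)"
    unfolding ab_hermitian_def
    by (auto simp: fun_eq_iff adjoint_map_def \<epsilon>_def adjoint_def out algebra_simps)
  moreover have "anti_ab_hermitian E (\<epsilon> (- 1))"
    unfolding anti_ab_hermitian_def
    by (auto simp: fun_eq_iff adjoint_map_def \<epsilon>_def adjoint_def out algebra_simps
        simp del: fps_const_neg simp flip: fps_const_neg)
  ultimately show ?thesis by blast
qed

end
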